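(* Let $\phi$ be a De Morgan formula over $x_1,\dots,x_n$ of size $s$ and depth $d$, and let $\mathbf{p}$ be a $q$-hiding random projection from $x_1,\dots,x_n$ to $y_1,\dots,y_m$. Then \[\mathbb{E}[L(\phi|_{\mathbf{p}})]=O\!\left(m^4\cdot q^2\cdot d^2\cdot s+m^2\cdot q\cdot\sqrt{s}\right).\]
   Context: A De Morgan formula is a binary tree whose leaves are labeled by literals and internal nodes by AND/OR; size is the number of leaves. $L(f)$ is the minimal size of a formula computing $f$ ($L$ of a constant is $0$); $L(\phi)$ is $L$ of the function computed by $\phi$. A projection $\pi$ from $x_1,\dots,x_n$ to $y_1,\dots,y_m$ is a map $\{x_1,\dots,x_n\}\to\{0,1,y_1,\overline{y_1},\dots,y_m,\overline{y_m}\}$, and $f|_\pi$ is the function of $y_1,\dots,y_m$ obtained by substituting $\pi(x_i)$ for $x_i$; a random projection is a distribution over projections. $\pi_{y_j\gets\sigma}$ is $\pi$ with $y_j$ substituted by $\sigma\in\{0,1\}$. A random projection $\mathbf{p}$ is $(q_0,q_1)$-hiding if for every projection $\pi$, every $\sigma\in\{0,1\}$ and every $x_i,y_j$: $\Pr[\mathbf{p}(x_i)\in\{y_j,\overline{y_j}\}\mid \mathbf{p}_{y_j\gets\sigma}=\pi]\le q_\sigma$ whenever the conditioning event has positive probability; it is $q$-hiding if it is $(q_0,q_1)$-hiding with $q=\sqrt{q_0q_1}$. *)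

theory Defs
  imports "HOL-Probability.Probability"
begin

text \<open>
  The variables \<open>x_1, \<dots>, x_n\<close> and \<open>y_1, \<dots>, y_m\<close> are represented by the indices in \<open>{..<n}\<close>
  and \<open>{..<m}\<close>. In a literal the Boolean is the sign: \<open>True\<close> is the plain variable, \<open>False\<close> its
  negation. A Boolean function of \<open>m\<close> variables is a predicate on \<open>nat \<Rightarrow> bool\<close> that depends on
  the arguments in \<open>{..<m}\<close> only.
\<close>

datatype formula =
    Lit bool nat
  | And formula formula
  | Or formula formula

fun formula_vars :: "formula \<Rightarrow> nat set" where
  "formula_vars (Lit b i) = {i}"
| "formula_vars (And \<phi> \<psi>) = formula_vars \<phi> \<union> formula_vars \<psi>"
| "formula_vars (Or \<phi> \<psi>) = formula_vars \<phi> \<union> formula_vars \<psi>"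

fun formula_eval :: "formula \<Rightarrow> (nat \<Rightarrow> bool) \<Rightarrow> bool" where
  "formula_eval (Lit b i) x = (if b then x i else \<not> x i)"
| "formula_eval (And \<phi> \<psi>) x = (formula_eval \<phi> x \<and> formula_eval \<psi> x)"
| "formula_eval (Or \<phi> \<psi>) x = (formula_eval \<phi> x \<or> formula_eval \<psi> x)"

fun formula_size :: "formula \<Rightarrow> nat" where
  "formula_size (Lit b i) = 1"
| "formula_size (And \<phi> \<psi>) = formula_size \<phi> + formula_size \<psi>"
| "formula_size (Or \<phi> \<psi>) = formula_size \<phi> + formula_size \<psi>"

text \<open>The depth is the number of edges on a longest path from the root to a leaf.\<close>

fun formula_depth :: "formula \<Rightarrow> nat" where
  "formula_depth (Lit b i) = 0"
| "formula_depth (And \<phi> \<psi>) = Suc (max (formula_depth \<phi>) (formula_depth \<psi>))"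
| "formula_depth (Or \<phi> \<psi>) = Suc (max (formula_depth \<phi>) (formula_depth \<psi>))"

definition formula_complexity :: "nat \<Rightarrow> ((nat \<Rightarrow> bool) \<Rightarrow> bool) \<Rightarrow> nat" where
  "formula_complexity m f =
     (if \<exists>c. \<forall>y. f y = c then 0
      else LEAST s. \<exists>\<psi>. formula_vars \<psi> \<subseteq> {..<m} \<and> formula_size \<psi> = s \<and>
                        (\<forall>y. formula_eval \<psi> y = f y))"

datatype proj_value = PConst bool | PLit bool nat

definition proj_values :: "nat \<Rightarrow> proj_value set" where
  "proj_values m = range PConst \<union> {PLit b j | b j. j < m}"

text \<open>
  Projections are extensional outside \<open>{..<n}\<close>, so that equality of projections, which is the
  conditioning event in the definition of hiding, is equality of maps on \<open>x_1, \<dots>, x_n\<close>.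
\<close>

definition projections :: "nat \<Rightarrow> nat \<Rightarrow> (nat \<Rightarrow> proj_value) set" where
  "projections n m = {..<n} \<rightarrow>\<^sub>E proj_values m"

fun value_eval :: "proj_value \<Rightarrow> (nat \<Rightarrow> bool) \<Rightarrow> bool" where
  "value_eval (PConst c) y = c"
| "value_eval (PLit b j) y = (if b then y j else \<not> y j)"

definition proj_apply ::
  "((nat \<Rightarrow> bool) \<Rightarrow> bool) \<Rightarrow> (nat \<Rightarrow> proj_value) \<Rightarrow> (nat \<Rightarrow> bool) \<Rightarrow> bool" where
  "proj_apply f \<pi> = (\<lambda>y. f (\<lambda>i. value_eval (\<pi> i) y))"

fun value_subst :: "nat \<Rightarrow> bool \<Rightarrow> proj_value \<Rightarrow> proj_value" where
  "value_subst j \<sigma> (PConst c) = PConst c"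
| "value_subst j \<sigma> (PLit b k) =
     (if k = j then PConst (if b then \<sigma> else \<not> \<sigma>) else PLit b k)"

definition proj_subst ::
  "nat \<Rightarrow> nat \<Rightarrow> bool \<Rightarrow> (nat \<Rightarrow> proj_value) \<Rightarrow> (nat \<Rightarrow> proj_value)" where
  "proj_subst n j \<sigma> \<pi> = (\<lambda>i\<in>{..<n}. value_subst j \<sigma> (\<pi> i))"

definition random_projection :: "nat \<Rightarrow> nat \<Rightarrow> (nat \<Rightarrow> proj_value) pmf \<Rightarrow> bool" where
  "random_projection n m p \<longleftrightarrow> set_pmf p \<subseteq> projections n m"

definition hiding2 ::
  "nat \<Rightarrow> nat \<Rightarrow> real \<Rightarrow> real \<Rightarrow> (nat \<Rightarrow> proj_value) pmf \<Rightarrow> bool" where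
  "hiding2 n m q0 q1 p \<longleftrightarrow>
     (\<forall>\<pi>\<in>projections n m. \<forall>\<sigma>. \<forall>i<n. \<forall>j<m.
        \<P>(\<rho> in measure_pmf p. proj_subst n j \<sigma> \<rho> = \<pi>) > 0 \<longrightarrow>
        \<P>(\<rho> in measure_pmf p. \<rho> i \<in> {PLit True j, PLit False j} \<bar> proj_subst n j \<sigma> \<rho> = \<pi>)
          \<le> (if \<sigma> then q1 else q0))"

definition hiding :: "nat \<Rightarrow> nat \<Rightarrow> real \<Rightarrow> (nat \<Rightarrow> proj_value) pmf \<Rightarrow> bool" where
  "hiding n m q p \<longleftrightarrow> (\<exists>q0 q1. hiding2 n m q0 q1 p \<and> q = sqrt (q0 * q1))"

end

theory Submission
  imports Defs
begin

text \<open>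
  Call a gate of \<open>\<phi>\<close> a bottom gate of \<open>\<pi>\<close> if its two children become literals of distinct variables
  under \<open>\<pi>\<close>. If \<open>L(\<phi>|\<pi>) \<ge> 2\<close>, there is a bottom gate, and since a gate has at most \<open>d\<close> gates above
  it, \<open>L(\<phi>|\<pi>)\<close> exceeds the indicator of \<open>\<phi>|\<pi>\<close> being non-constant by at most \<open>d\<close> times the number
  of bottom gates. A Khrapchenko argument, by induction on the formula with Cauchy-Schwarz at the
  gates, shows that \<open>\<phi>|p\<close> is a given literal with probability at most \<open>q \<surd>s\<close>. The argument
  may be restricted to an event that survives fixing that literal's variable, and fixing variables
  preserves hiding; so the two children of a gate, of sizes \<open>s\<^sub>1\<close> and \<open>s\<^sub>2\<close>, become two given
  literals of distinct variables with probability at most \<open>q\<^sup>2 \<surd>(s\<^sub>1 s\<^sub>2)\<close>. Summing over the gates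
  costs another factor \<open>d\<close>.
\<close>

section \<open>Projections and substitution\<close>

lemma formula_eval_cong:
  assumes "\<And>i. i \<in> formula_vars \<phi> \<Longrightarrow> x i = x' i"
  shows "formula_eval \<phi> x = formula_eval \<phi> x'"
  using assms by (induction \<phi>) auto

lemma formula_eval_Lit: "formula_eval (Lit b i) x \<longleftrightarrow> x i = b"
  by simp

lemma value_eval_value_subst:
  "value_eval (value_subst j \<sigma> v) y = value_eval v (y(j := \<sigma>))"
  by (cases v) auto

text \<open>\<open>proj_subst\<close> is \<open>undefined\<close> outside \<open>{..<n}\<close>; the
  hypothesis on the variables keeps the formula from reading those positions.\<close>

lemma proj_apply_proj_subst:
  assumes "formula_vars \<phi> \<subseteq> {..<n}"
  shows "proj_apply (formula_eval \<phi>) (proj_subst n j \<sigma> \<pi>) y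
       = proj_apply (formula_eval \<phi>) \<pi> (y(j := \<sigma>))"
  unfolding proj_apply_def
  by (rule formula_eval_cong) (use assms in \<open>auto simp: proj_subst_def value_eval_value_subst\<close>)

lemma value_subst_commute:
  "j \<noteq> k \<Longrightarrow> value_subst j \<sigma> (value_subst k \<tau> v) = value_subst k \<tau> (value_subst j \<sigma> v)"
  by (cases v) auto

lemma proj_subst_commute:
  "j \<noteq> k \<Longrightarrow> proj_subst n j \<sigma> (proj_subst n k \<tau> \<pi>) = proj_subst n k \<tau> (proj_subst n j \<sigma> \<pi>)"
  by (auto simp: proj_subst_def value_subst_commute fun_eq_iff)

lemma proj_subst_in_projections:
  assumes "\<pi> \<in> projections n m"
  shows "proj_subst n j \<sigma> \<pi> \<in> projections n m"
proof -
  have "value_subst j \<sigma> v \<in> proj_values m" if "v \<in> proj_values m" for v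
    using that by (cases v) (auto simp: proj_values_def)
  then show ?thesis
    using assms by (auto simp: projections_def proj_subst_def PiE_iff)
qed

lemma value_subst_eq_PLit_iff:
  "value_subst k \<tau> v = PLit b j \<longleftrightarrow> v = PLit b j \<and> j \<noteq> k"
  by (cases v) auto

text \<open>This turns a disagreement between the two ways of fixing \<open>y_j\<close> into the
  event whose probability hiding bounds.\<close>

lemma value_subst_neq_imp_PLit:
  "value_subst j \<sigma> v \<noteq> value_subst j \<tau> v \<Longrightarrow> v \<in> {PLit True j, PLit False j}"
  by (cases v) (auto split: if_splits)

lemma finite_projections: "finite (projections n m)"
proof -
  have "{PLit b j | b j. j < m} = (\<lambda>(b, j). PLit b j) ` (UNIV \<times> {..<m})"
    by auto
  then have "finite {PLit b j | b j. j < m}"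
    by simp
  then show ?thesis
    by (auto simp: projections_def proj_values_def intro!: finite_PiE)
qed

lemma finite_set_pmf_random_projection:
  "random_projection n m p \<Longrightarrow> finite (set_pmf p)"
  unfolding random_projection_def using finite_projections finite_subset by blast

section \<open>Hiding without conditioning\<close>

text \<open>Hiding with the conditional probability multiplied out, which removes the positivity
  condition. A set \<open>A\<close> replaces the single projection, because the Khrapchenko argument
  works with sets and preimages.\<close>

definition set_hiding :: "nat \<Rightarrow> nat \<Rightarrow> (bool \<Rightarrow> real) \<Rightarrow> (nat \<Rightarrow> proj_value) pmf \<Rightarrow> bool" where
  "set_hiding n m Q p \<longleftrightarrow>
     (\<forall>\<sigma> i j A. i < n \<longrightarrow> j < m \<longrightarrow>
        measure_pmf.prob p {\<rho>. \<rho> i \<in> {PLit True j, PLit False j} \<and> proj_subst n j \<sigma> \<rho> \<in> A}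
          \<le> Q \<sigma> * measure_pmf.prob p {\<rho>. proj_subst n j \<sigma> \<rho> \<in> A})"

lemma prob_fibers:
  fixes p :: "'a pmf" and f :: "'a \<Rightarrow> 'b"
  assumes "finite (set_pmf p)"
  shows "measure_pmf.prob p {x. P x \<and> f x \<in> A}
       = (\<Sum>b\<in>f ` set_pmf p \<inter> A. measure_pmf.prob p {x. P x \<and> f x = b})"
proof -
  have "measure_pmf.prob p {x. P x \<and> f x \<in> A}
      = measure_pmf.prob p (\<Union>b\<in>f ` set_pmf p \<inter> A. {x. P x \<and> f x = b})"
    by (rule measure_pmf.finite_measure_eq_AE) (auto simp: AE_measure_pmf_iff)
  also have "\<dots> = (\<Sum>b\<in>f ` set_pmf p \<inter> A. measure_pmf.prob p {x. P x \<and> f x = b})"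
    by (rule measure_pmf.finite_measure_finite_Union)
       (use assms in \<open>auto simp: disjoint_family_on_def\<close>)
  finally show ?thesis .
qed

lemma hiding2_imp_set_hiding:
  assumes rp: "random_projection n m p" and hid: "hiding2 n m q0 q1 p"
  shows "set_hiding n m (\<lambda>\<sigma>. if \<sigma> then q1 else q0) p"
  unfolding set_hiding_def
proof (intro allI impI)
  fix \<sigma> i j A assume ij: "i < n" "j < m"
  let ?H = "\<lambda>\<rho>. \<rho> i \<in> {PLit True j, PLit False j}"
  let ?f = "proj_subst n j \<sigma>" and ?q = "if \<sigma> then q1 else q0"
  have fin: "finite (set_pmf p)"
    using rp by (rule finite_set_pmf_random_projection)
  \<comment> \<open>Over the image of the support the conditioning event has positive probability,
    so the conditional bound is available and can be multiplied out.\<close>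
  have fiber: "measure_pmf.prob p {\<rho>. ?H \<rho> \<and> ?f \<rho> = \<pi>} \<le> ?q * measure_pmf.prob p {\<rho>. ?f \<rho> = \<pi>}"
    if "\<pi> \<in> ?f ` set_pmf p" for \<pi>
  proof -
    have \<pi>: "\<pi> \<in> projections n m"
      using that rp by (auto simp: random_projection_def intro: proj_subst_in_projections)
    have pos: "measure_pmf.prob p {\<rho>. ?f \<rho> = \<pi>} > 0"
      using that by (auto intro!: measure_pmf_posI)
    have "\<P>(\<rho> in measure_pmf p. ?H \<rho> \<bar> ?f \<rho> = \<pi>) \<le> ?q"
      using hid \<pi> ij pos unfolding hiding2_def by auto
    then show ?thesis
      using pos by (simp add: cond_prob_def divide_simps)
  qed
  have "measure_pmf.prob p {\<rho>. ?H \<rho> \<and> ?f \<rho> \<in> A}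
      \<le> (\<Sum>\<pi>\<in>?f ` set_pmf p \<inter> A. ?q * measure_pmf.prob p {\<rho>. ?f \<rho> = \<pi>})"
    unfolding prob_fibers[OF fin, of ?H ?f A] by (intro sum_mono fiber) auto
  also have "\<dots> = ?q * measure_pmf.prob p {\<rho>. ?f \<rho> \<in> A}"
    using prob_fibers[OF fin, of "\<lambda>_. True" ?f A] by (simp add: sum_distrib_left)
  finally show "measure_pmf.prob p {\<rho>. ?H \<rho> \<and> ?f \<rho> \<in> A} \<le> ?q * measure_pmf.prob p {\<rho>. ?f \<rho> \<in> A}" .
qed

text \<open>The parameters of hiding are arbitrary reals. Once there is an \<open>x_i\<close> and a
  \<open>y_j\<close>, taking \<open>A = UNIV\<close> shows that \<open>Q \<sigma>\<close> bounds a
  probability from above.\<close>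

lemma set_hiding_nonneg:
  assumes "set_hiding n m Q p" "0 < n" "0 < m"
  shows "0 \<le> Q \<sigma>"
proof -
  have "measure_pmf.prob p {\<rho>. \<rho> 0 \<in> {PLit True 0, PLit False 0} \<and> proj_subst n 0 \<sigma> \<rho> \<in> UNIV}
      \<le> Q \<sigma> * measure_pmf.prob p {\<rho>. proj_subst n 0 \<sigma> \<rho> \<in> UNIV}"
    using assms unfolding set_hiding_def by blast
  then have "measure_pmf.prob p {\<rho>. \<rho> 0 \<in> {PLit True 0, PLit False 0}} \<le> Q \<sigma>"
    by simp
  then show ?thesis
    using measure_nonneg order_trans by blast
qed

text \<open>For \<open>j \<noteq> k\<close> the two substitutions commute, so the claim for
  \<open>A\<close> is the hiding of \<open>p\<close> at the preimage of \<open>A\<close>. For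
  \<open>j = k\<close> no \<open>y_j\<close> is left: the left side is 0 and nonnegativity of
  \<open>Q\<close> suffices.\<close>

lemma set_hiding_map_proj_subst:
  assumes hid: "set_hiding n m Q p" and nonneg: "\<And>\<sigma>. 0 \<le> Q \<sigma>"
  shows "set_hiding n m Q (map_pmf (proj_subst n k \<tau>) p)"
  unfolding set_hiding_def
proof (intro allI impI)
  fix \<sigma> i j A assume ij: "i < n" "j < m"
  let ?f = "proj_subst n j \<sigma>" and ?g = "proj_subst n k \<tau>"
  have lit: "?g \<rho> i \<in> {PLit True j, PLit False j} \<longleftrightarrow> \<rho> i \<in> {PLit True j, PLit False j} \<and> j \<noteq> k" for \<rho>
    using ij by (auto simp: proj_subst_def value_subst_eq_PLit_iff)
  show "measure_pmf.prob (map_pmf ?g p) {\<rho>. \<rho> i \<in> {PLit True j, PLit False j} \<and> ?f \<rho> \<in> A}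
      \<le> Q \<sigma> * measure_pmf.prob (map_pmf ?g p) {\<rho>. ?f \<rho> \<in> A}"
  proof (cases "j = k")
    case True
    then have "measure_pmf.prob (map_pmf ?g p) {\<rho>. \<rho> i \<in> {PLit True j, PLit False j} \<and> ?f \<rho> \<in> A} = 0"
      unfolding measure_map_pmf vimage_def mem_Collect_eq lit by simp
    then show ?thesis
      using nonneg by simp
  next
    case False
    have "measure_pmf.prob p {\<rho>. \<rho> i \<in> {PLit True j, PLit False j} \<and> ?f \<rho> \<in> ?g -` A}
        \<le> Q \<sigma> * measure_pmf.prob p {\<rho>. ?f \<rho> \<in> ?g -` A}"
      using hid ij unfolding set_hiding_def by blast
    then show ?thesis
      using False unfolding measure_map_pmf vimage_def mem_Collect_eq lit
      by (simp add: proj_subst_commute)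
  qed
qed

section \<open>The Khrapchenko bound\<close>

text \<open>Cauchy-Schwarz for \<open>(sqrt a, sqrt b)\<close> and \<open>(sqrt x, sqrt y)\<close>:
  after squaring, the cross term is bounded by AM-GM applied to \<open>a * y\<close> and
  \<open>b * x\<close>.\<close>

lemma sqrt_mult_add_le:
  assumes "0 \<le> a" "0 \<le> b" "0 \<le> x" "0 \<le> y"
  shows "sqrt (a * x) + sqrt (b * y) \<le> sqrt ((a + b) * (x + y))"
proof (rule real_le_rsqrt)
  have eq: "(sqrt (a * x) + sqrt (b * y))\<^sup>2 = a * x + b * y + 2 * sqrt ((a * y) * (b * x))"
    using assms by (simp add: power2_sum real_sqrt_mult algebra_simps)
  have "sqrt ((a * y) * (b * x)) \<le> (a * y + b * x) / 2"
    by (rule arith_geo_mean_sqrt) (use assms in auto)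
  then show "(sqrt (a * x) + sqrt (b * y))\<^sup>2 \<le> (a + b) * (x + y)"
    unfolding eq by (simp add: algebra_simps)
qed

lemma prob_split_mono:
  fixes p :: "'a pmf"
  assumes "\<And>x. R x \<Longrightarrow> S x \<or> T x"
  shows "measure_pmf.prob p {x. R x} \<le> measure_pmf.prob p {x. S x} + measure_pmf.prob p {x. T x}"
proof -
  have "measure_pmf.prob p {x. R x} \<le> measure_pmf.prob p ({x. S x} \<union> {x. T x})"
    by (rule measure_pmf.finite_measure_mono) (use assms in auto)
  also have "\<dots> \<le> measure_pmf.prob p {x. S x} + measure_pmf.prob p {x. T x}"
    by (rule measure_Un_le) auto
  finally show ?thesis .
qed

lemma prob_split_disjoint:
  fixes p :: "'a pmf" and f :: "'a \<Rightarrow> 'b"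
  assumes "A = A1 \<union> A2" "A1 \<inter> A2 = {}"
  shows "measure_pmf.prob p {x. f x \<in> A}
       = measure_pmf.prob p {x. f x \<in> A1} + measure_pmf.prob p {x. f x \<in> A2}"
proof -
  have "{x. f x \<in> A} = {x. f x \<in> A1} \<union> {x. f x \<in> A2}"
    using assms by auto
  then show ?thesis
    using assms by (simp add: measure_pmf.finite_measure_Union disjoint_iff)
qed

text \<open>
  The sets \<open>A\<close> and \<open>B\<close> only have to be separated at a single point \<open>y\<close>: this is what makes the
  induction split \<open>A\<close> (at an AND gate) or \<open>B\<close> (at an OR gate) in two.
\<close>

lemma khrapchenko_set_hiding:
  assumes hid: "set_hiding n m Q p" and nonneg: "\<And>\<sigma>. 0 \<le> Q \<sigma>" and j: "j < m"
    and "formula_vars \<phi> \<subseteq> {..<n}"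
    and "\<And>a. a \<in> A \<Longrightarrow> \<not> proj_apply (formula_eval \<phi>) a y"
    and "\<And>b. b \<in> B \<Longrightarrow> proj_apply (formula_eval \<phi>) b y"
  shows "measure_pmf.prob p {\<rho>. proj_subst n j \<sigma> \<rho> \<in> A \<and> proj_subst n j (\<not> \<sigma>) \<rho> \<in> B}
       \<le> sqrt (Q False * Q True) * sqrt (formula_size \<phi> *
           (measure_pmf.prob p {\<rho>. proj_subst n j \<sigma> \<rho> \<in> A} *
            measure_pmf.prob p {\<rho>. proj_subst n j (\<not> \<sigma>) \<rho> \<in> B}))"
  using assms(4-)
proof (induction \<phi> arbitrary: A B)
  case (Lit b i)
  let ?f = "proj_subst n j \<sigma>" and ?g = "proj_subst n j (\<not> \<sigma>)"
  let ?H = "\<lambda>\<rho>. \<rho> i \<in> {PLit True j, PLit False j}"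
  let ?W = "measure_pmf.prob p {\<rho>. ?f \<rho> \<in> A \<and> ?g \<rho> \<in> B}"
  let ?a = "measure_pmf.prob p {\<rho>. ?f \<rho> \<in> A}" and ?b = "measure_pmf.prob p {\<rho>. ?g \<rho> \<in> B}"
  have i: "i < n"
    using Lit.prems by simp
  \<comment> \<open>At a leaf, separation at \<open>y\<close> forces the two restrictions to differ
    at \<open>x_i\<close>, so \<open>x_i\<close> is mapped to \<open>y_j\<close> or its
    negation.\<close>
  have H: "?H \<rho>" if "?f \<rho> \<in> A" "?g \<rho> \<in> B" for \<rho>
  proof -
    have "?f \<rho> i \<noteq> ?g \<rho> i"
      using Lit.prems(2)[OF that(1)] Lit.prems(3)[OF that(2)] by (auto simp: proj_apply_def split: if_splits)
    then show ?thesis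
      using i by (intro value_subst_neq_imp_PLit[of j \<sigma> _ "\<not> \<sigma>"]) (simp add: proj_subst_def)
  qed
  have "?W \<le> measure_pmf.prob p {\<rho>. ?H \<rho> \<and> ?f \<rho> \<in> A}"
    by (rule measure_pmf.finite_measure_mono) (use H in blast, simp)
  also have "\<dots> \<le> Q \<sigma> * ?a"
    using hid i j unfolding set_hiding_def by blast
  finally have Wa: "?W \<le> Q \<sigma> * ?a" .
  have "?W \<le> measure_pmf.prob p {\<rho>. ?H \<rho> \<and> ?g \<rho> \<in> B}"
    by (rule measure_pmf.finite_measure_mono) (use H in blast, simp)
  also have "\<dots> \<le> Q (\<not> \<sigma>) * ?b"
    using hid i j unfolding set_hiding_def by blast
  \<comment> \<open>The event is bounded once through \<open>A\<close> and once through
    \<open>B\<close>, with opposite parameters; the geometric mean of the two bounds has the factor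
    \<open>sqrt (Q False * Q True)\<close> for either \<open>\<sigma>\<close>.\<close>
  finally have "?W * ?W \<le> (Q \<sigma> * ?a) * (Q (\<not> \<sigma>) * ?b)"
    using Wa nonneg by (intro mult_mono) auto
  also have "\<dots> = (Q False * Q True) * (?a * ?b)"
    by (cases \<sigma>) auto
  finally have "?W \<le> sqrt ((Q False * Q True) * (?a * ?b))"
    by (intro real_le_rsqrt) (simp add: power2_eq_square)
  then show ?case
    by (simp add: real_sqrt_mult)
next
  case (And \<phi>1 \<phi>2)
  let ?f = "proj_subst n j \<sigma>" and ?g = "proj_subst n j (\<not> \<sigma>)" and ?q = "sqrt (Q False * Q True)"
  \<comment> \<open>On \<open>A2\<close> the gate is false but its first child is true, so the
    second child is false. On \<open>B\<close> both children are true; hence each half of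
    \<open>A\<close> is separated from all of \<open>B\<close> by one child.\<close>
  define A1 A2 where "A1 = {a \<in> A. \<not> proj_apply (formula_eval \<phi>1) a y}" and "A2 = A - A1"
  let ?W = "\<lambda>A B. measure_pmf.prob p {\<rho>. ?f \<rho> \<in> A \<and> ?g \<rho> \<in> B}"
  let ?a = "\<lambda>A. measure_pmf.prob p {\<rho>. ?f \<rho> \<in> A}" and ?b = "measure_pmf.prob p {\<rho>. ?g \<rho> \<in> B}"
  have 1: "?W A1 B \<le> ?q * sqrt (formula_size \<phi>1 * (?a A1 * ?b))"
    by (rule And.IH) (use And.prems in \<open>auto simp: A1_def proj_apply_def\<close>)
  have 2: "?W A2 B \<le> ?q * sqrt (formula_size \<phi>2 * (?a A2 * ?b))"
    by (rule And.IH) (use And.prems in \<open>auto simp: A2_def A1_def proj_apply_def\<close>)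
  have sum: "?a A = ?a A1 + ?a A2"
    by (rule prob_split_disjoint) (auto simp: A1_def A2_def)
  have "?W A B \<le> ?W A1 B + ?W A2 B"
    by (rule prob_split_mono) (auto simp: A2_def)
  also have "\<dots> \<le> ?q * (sqrt (formula_size \<phi>1 * (?a A1 * ?b)) + sqrt (formula_size \<phi>2 * (?a A2 * ?b)))"
    using 1 2 by (simp add: distrib_left)
  \<comment> \<open>Cauchy-Schwarz pairs the leaf counts with the probabilities. Both add up to the
    values of the gate, since \<open>?b\<close> is common to the two halves.\<close>
  also have "\<dots> \<le> ?q * sqrt ((real (formula_size \<phi>1) + real (formula_size \<phi>2)) * (?a A1 * ?b + ?a A2 * ?b))"
    using nonneg by (intro mult_left_mono sqrt_mult_add_le) auto
  finally show ?case
    unfolding sum by (simp add: distrib_right)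
next
  case (Or \<phi>1 \<phi>2)
  let ?f = "proj_subst n j \<sigma>" and ?g = "proj_subst n j (\<not> \<sigma>)" and ?q = "sqrt (Q False * Q True)"
  \<comment> \<open>Dually, both children are false on \<open>A\<close>, and on \<open>B2\<close>
    the second child must be the true one.\<close>
  define B1 B2 where "B1 = {b \<in> B. proj_apply (formula_eval \<phi>1) b y}" and "B2 = B - B1"
  let ?W = "\<lambda>A B. measure_pmf.prob p {\<rho>. ?f \<rho> \<in> A \<and> ?g \<rho> \<in> B}"
  let ?a = "measure_pmf.prob p {\<rho>. ?f \<rho> \<in> A}" and ?b = "\<lambda>B. measure_pmf.prob p {\<rho>. ?g \<rho> \<in> B}"
  have 1: "?W A B1 \<le> ?q * sqrt (formula_size \<phi>1 * (?a * ?b B1))"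
    by (rule Or.IH) (use Or.prems in \<open>auto simp: B1_def proj_apply_def\<close>)
  have 2: "?W A B2 \<le> ?q * sqrt (formula_size \<phi>2 * (?a * ?b B2))"
    by (rule Or.IH) (use Or.prems in \<open>auto simp: B2_def B1_def proj_apply_def\<close>)
  have sum: "?b B = ?b B1 + ?b B2"
    by (rule prob_split_disjoint) (auto simp: B1_def B2_def)
  have "?W A B \<le> ?W A B1 + ?W A B2"
    by (rule prob_split_mono) (auto simp: B2_def)
  also have "\<dots> \<le> ?q * (sqrt (formula_size \<phi>1 * (?a * ?b B1)) + sqrt (formula_size \<phi>2 * (?a * ?b B2)))"
    using 1 2 by (simp add: distrib_left)
  also have "\<dots> \<le> ?q * sqrt ((real (formula_size \<phi>1) + real (formula_size \<phi>2)) * (?a * ?b B1 + ?a * ?b B2))"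
    using nonneg by (intro mult_left_mono sqrt_mult_add_le) auto
  finally show ?case
    unfolding sum by (simp add: distrib_left)
qed

text \<open>If the restricted function is the literal, fixing \<open>y_j\<close> to
  \<open>\<not> b\<close> makes it false everywhere and fixing it to \<open>b\<close> makes it true
  everywhere. The Khrapchenko bound then applies to the sets separated at the all-False point, whose
  probabilities are at most 1.\<close>

lemma prob_literal_le:
  assumes hid: "set_hiding n m Q p" and nonneg: "\<And>\<sigma>. 0 \<le> Q \<sigma>" and j: "j < m"
    and vars: "formula_vars \<phi> \<subseteq> {..<n}"
  shows "measure_pmf.prob p {\<rho>. proj_apply (formula_eval \<phi>) \<rho> = formula_eval (Lit b j)}
       \<le> sqrt (Q False * Q True) * sqrt (formula_size \<phi>)"
proof -
  let ?F = "proj_apply (formula_eval \<phi>)" and ?f = "\<lambda>\<sigma>. proj_subst n j \<sigma>" and ?y = "\<lambda>_. False"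
  define A B where "A = {a. \<not> ?F a ?y}" and "B = {a. ?F a ?y}"
  let ?a = "measure_pmf.prob p {\<rho>. ?f (\<not> b) \<rho> \<in> A}"
  let ?b = "measure_pmf.prob p {\<rho>. ?f (\<not> \<not> b) \<rho> \<in> B}"
  have "measure_pmf.prob p {\<rho>. ?F \<rho> = formula_eval (Lit b j)}
      \<le> measure_pmf.prob p {\<rho>. ?f (\<not> b) \<rho> \<in> A \<and> ?f (\<not> \<not> b) \<rho> \<in> B}"
    by (rule measure_pmf.finite_measure_mono)
       (auto simp: A_def B_def proj_apply_proj_subst[OF vars] formula_eval_Lit simp del: formula_eval.simps)
  also have "\<dots> \<le> sqrt (Q False * Q True) * sqrt (formula_size \<phi> * (?a * ?b))"
    by (rule khrapchenko_set_hiding[OF hid nonneg j vars]) (auto simp: A_def B_def)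
  also have "\<dots> \<le> sqrt (Q False * Q True) * sqrt (real (formula_size \<phi>) * 1)"
  proof (intro mult_left_mono real_sqrt_le_mono)
    show "?a * ?b \<le> 1"
      by (intro mult_le_one) auto
  qed (use nonneg in auto)
  finally show ?thesis
    by simp
qed

text \<open>The sets of the one-literal argument are intersected with the event that
  \<open>\<psi>\<close> is the literal of \<open>y_k\<close>. Their probabilities are then no longer
  bounded by 1 but by the one-literal bound for \<open>\<psi>\<close>, which contributes the second
  factor \<open>sqrt (Q False * Q True)\<close>.\<close>

lemma prob_two_literals_le:
  assumes hid: "set_hiding n m Q p" and nonneg: "\<And>\<sigma>. 0 \<le> Q \<sigma>" and j: "j < m" and k: "k < m"
    and jk: "j \<noteq> k"
    and vars: "formula_vars \<phi> \<subseteq> {..<n}" "formula_vars \<psi> \<subseteq> {..<n}"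
  shows "measure_pmf.prob p {\<rho>. proj_apply (formula_eval \<phi>) \<rho> = formula_eval (Lit b j) \<and>
                               proj_apply (formula_eval \<psi>) \<rho> = formula_eval (Lit c k)}
       \<le> Q False * Q True * sqrt (real (formula_size \<phi>) * real (formula_size \<psi>))"
proof -
  let ?F = "proj_apply (formula_eval \<phi>)" and ?G = "proj_apply (formula_eval \<psi>)"
  let ?f = "\<lambda>\<sigma>. proj_subst n j \<sigma>" and ?y = "\<lambda>_. False" and ?q = "sqrt (Q False * Q True)"
  let ?l = "formula_eval (Lit c k)" and ?s = "real (formula_size \<phi>)" and ?t = "real (formula_size \<psi>)"
  define A B where "A = {a. \<not> ?F a ?y \<and> ?G a = ?l}" and "B = {a. ?F a ?y \<and> ?G a = ?l}"
  let ?a = "measure_pmf.prob p {\<rho>. ?f (\<not> b) \<rho> \<in> A}"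
  let ?b = "measure_pmf.prob p {\<rho>. ?f (\<not> \<not> b) \<rho> \<in> B}"
  \<comment> \<open>A literal of \<open>y_k\<close> does not depend on \<open>y_j\<close>, so the
    event survives fixing \<open>y_j\<close>.\<close>
  have G: "?G (?f \<sigma> \<rho>) = ?l" if "?G \<rho> = ?l" for \<rho> \<sigma>
    using that jk by (auto simp: fun_eq_iff proj_apply_proj_subst[OF vars(2)])
  \<comment> \<open>The one-literal bound is applied to the random projection with
    \<open>y_j\<close> already fixed, which is still hiding.\<close>
  have fixed: "measure_pmf.prob p {\<rho>. ?f \<sigma> \<rho> \<in> S} \<le> ?q * sqrt ?t"
    if S: "S \<subseteq> {a. ?G a = ?l}" for S \<sigma>
  proof -
    have "measure_pmf.prob p {\<rho>. ?f \<sigma> \<rho> \<in> S}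
        \<le> measure_pmf.prob (map_pmf (?f \<sigma>) p) {\<rho>. ?G \<rho> = ?l}"
      unfolding measure_map_pmf
      by (rule measure_pmf.finite_measure_mono) (use S in auto)
    also have "\<dots> \<le> ?q * sqrt ?t"
      by (rule prob_literal_le[OF set_hiding_map_proj_subst[OF hid nonneg] nonneg k vars(2)])
    finally show ?thesis .
  qed
  have q0: "0 \<le> ?q"
    using nonneg by simp
  have "measure_pmf.prob p {\<rho>. ?F \<rho> = formula_eval (Lit b j) \<and> ?G \<rho> = ?l}
      \<le> measure_pmf.prob p {\<rho>. ?f (\<not> b) \<rho> \<in> A \<and> ?f (\<not> \<not> b) \<rho> \<in> B}"
    by (rule measure_pmf.finite_measure_mono)
       (auto simp: A_def B_def proj_apply_proj_subst[OF vars(1)] G formula_eval_Lit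
             simp del: formula_eval.simps)
  also have "\<dots> \<le> ?q * sqrt (?s * (?a * ?b))"
    by (rule khrapchenko_set_hiding[OF hid nonneg j vars(1)]) (auto simp: A_def B_def)
  also have "\<dots> \<le> ?q * sqrt (?s * ((?q * sqrt ?t) * (?q * sqrt ?t)))"
    using q0 by (intro mult_left_mono real_sqrt_le_mono mult_mono fixed) (auto simp: A_def B_def)
  also have "\<dots> = Q False * Q True * sqrt (?s * ?t)"
  proof -
    have "(?q * sqrt ?t) * (?q * sqrt ?t) = (Q False * Q True) * ?t"
      using nonneg by (simp add: algebra_simps)
    then have "sqrt (?s * ((?q * sqrt ?t) * (?q * sqrt ?t))) = ?q * sqrt (?s * ?t)"
      by (simp add: real_sqrt_mult)
    then show ?thesis
      using nonneg by simp
  qed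
  finally show ?thesis .
qed

section \<open>Formula complexity and bottom gates\<close>

text \<open>Formulas have no constant leaves, so for \<open>m = 0\<close> no function is
  representable. Constants are therefore carried along as a separate case.\<close>

definition representable :: "nat \<Rightarrow> ((nat \<Rightarrow> bool) \<Rightarrow> bool) \<Rightarrow> bool" where
  "representable m f \<longleftrightarrow> (\<exists>\<psi>. formula_vars \<psi> \<subseteq> {..<m} \<and> formula_eval \<psi> = f)"

lemma formula_size_pos: "0 < formula_size \<phi>"
  by (induction \<phi>) auto

lemma formula_complexity_const [simp]: "formula_complexity m (\<lambda>_. c) = 0"
  by (simp add: formula_complexity_def)

lemma formula_complexity_le:
  assumes "formula_vars \<psi> \<subseteq> {..<m}"
  shows "formula_complexity m (formula_eval \<psi>) \<le> formula_size \<psi>"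
  unfolding formula_complexity_def using assms by (auto intro!: Least_le)

lemma obtain_minimal_formula:
  assumes "representable m f" "\<nexists>c. f = (\<lambda>_. c)"
  obtains \<psi> where "formula_vars \<psi> \<subseteq> {..<m}" "formula_size \<psi> = formula_complexity m f"
    "formula_eval \<psi> = f"
proof -
  let ?P = "\<lambda>s. \<exists>\<psi>. formula_vars \<psi> \<subseteq> {..<m} \<and> formula_size \<psi> = s \<and> (\<forall>y. formula_eval \<psi> y = f y)"
  have "\<exists>s. ?P s"
    using assms(1) unfolding representable_def by blast
  then have "?P (LEAST s. ?P s)"
    by (rule LeastI_ex)
  moreover have "formula_complexity m f = (LEAST s. ?P s)"
    using assms(2) by (auto simp: formula_complexity_def fun_eq_iff)
  ultimately obtain \<psi> where "formula_vars \<psi> \<subseteq> {..<m}" "formula_size \<psi> = formula_complexity m f"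
    "\<forall>y. formula_eval \<psi> y = f y"
    by auto
  then show thesis
    by (intro that) auto
qed

lemma formula_complexity_conj_le:
  assumes "representable m f" "representable m g" "\<nexists>c. f = (\<lambda>_. c)" "\<nexists>c. g = (\<lambda>_. c)"
  shows "formula_complexity m (\<lambda>y. f y \<and> g y) \<le> formula_complexity m f + formula_complexity m g"
proof -
  obtain \<phi> where \<phi>: "formula_vars \<phi> \<subseteq> {..<m}" "formula_size \<phi> = formula_complexity m f" "formula_eval \<phi> = f"
    using obtain_minimal_formula assms(1,3) by metis
  obtain \<psi> where \<psi>: "formula_vars \<psi> \<subseteq> {..<m}" "formula_size \<psi> = formula_complexity m g" "formula_eval \<psi> = g"
    using obtain_minimal_formula assms(2,4) by metis
  have "formula_eval (And \<phi> \<psi>) = (\<lambda>y. f y \<and> g y)"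
    using \<phi> \<psi> by auto
  then show ?thesis
    using formula_complexity_le[of "And \<phi> \<psi>" m] \<phi> \<psi> by simp
qed

lemma formula_complexity_disj_le:
  assumes "representable m f" "representable m g" "\<nexists>c. f = (\<lambda>_. c)" "\<nexists>c. g = (\<lambda>_. c)"
  shows "formula_complexity m (\<lambda>y. f y \<or> g y) \<le> formula_complexity m f + formula_complexity m g"
proof -
  obtain \<phi> where \<phi>: "formula_vars \<phi> \<subseteq> {..<m}" "formula_size \<phi> = formula_complexity m f" "formula_eval \<phi> = f"
    using obtain_minimal_formula assms(1,3) by metis
  obtain \<psi> where \<psi>: "formula_vars \<psi> \<subseteq> {..<m}" "formula_size \<psi> = formula_complexity m g" "formula_eval \<psi> = g"
    using obtain_minimal_formula assms(2,4) by metis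
  have "formula_eval (Or \<phi> \<psi>) = (\<lambda>y. f y \<or> g y)"
    using \<phi> \<psi> by auto
  then show ?thesis
    using formula_complexity_le[of "Or \<phi> \<psi>" m] \<phi> \<psi> by simp
qed

lemma complexity_le_1_imp_literal:
  assumes "representable m f" "\<nexists>c. f = (\<lambda>_. c)" "formula_complexity m f \<le> 1"
  obtains b j where "j < m" "f = formula_eval (Lit b j)"
proof -
  obtain \<psi> where \<psi>: "formula_vars \<psi> \<subseteq> {..<m}" "formula_size \<psi> \<le> 1" "formula_eval \<psi> = f"
    using obtain_minimal_formula[OF assms(1,2)] assms(3) by metis
  then show thesis
  proof (cases \<psi>)
    case (Lit b j)
    then show thesis using \<psi> that[of j b] by auto
  next
    case (And \<psi>1 \<psi>2)
    then show thesis
      using \<psi> formula_size_pos[of \<psi>1] formula_size_pos[of \<psi>2] by simp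
  next
    case (Or \<psi>1 \<psi>2)
    then show thesis
      using \<psi> formula_size_pos[of \<psi>1] formula_size_pos[of \<psi>2] by simp
  qed
qed

lemma formula_complexity_literal_le: "j < m \<Longrightarrow> formula_complexity m (formula_eval (Lit b j)) \<le> 1"
  using formula_complexity_le[of "Lit b j" m] by simp

text \<open>Two literals of the same variable are left out because a gate over them collapses to a
  literal or a constant.\<close>

definition distinct_literals ::
  "nat \<Rightarrow> ((nat \<Rightarrow> bool) \<Rightarrow> bool) \<Rightarrow> ((nat \<Rightarrow> bool) \<Rightarrow> bool) \<Rightarrow> bool" where
  "distinct_literals m f g \<longleftrightarrow>
     (\<exists>b c j k. j < m \<and> k < m \<and> j \<noteq> k \<and> f = formula_eval (Lit b j) \<and> g = formula_eval (Lit c k))"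

text \<open>The test concerns the functions that the two subformulas compute under \<pi>, not their
  syntax, so a bottom gate can have large children.\<close>

fun bottom_gates :: "nat \<Rightarrow> formula \<Rightarrow> (nat \<Rightarrow> proj_value) \<Rightarrow> nat" where
  "bottom_gates m (Lit b i) \<pi> = 0"
| "bottom_gates m (And \<phi> \<psi>) \<pi> = bottom_gates m \<phi> \<pi> + bottom_gates m \<psi> \<pi> +
     of_bool (distinct_literals m (proj_apply (formula_eval \<phi>) \<pi>) (proj_apply (formula_eval \<psi>) \<pi>))"
| "bottom_gates m (Or \<phi> \<psi>) \<pi> = bottom_gates m \<phi> \<pi> + bottom_gates m \<psi> \<pi> +
     of_bool (distinct_literals m (proj_apply (formula_eval \<phi>) \<pi>) (proj_apply (formula_eval \<psi>) \<pi>))"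

lemma proj_apply_And:
  "proj_apply (formula_eval (And \<phi> \<psi>)) \<pi> =
     (\<lambda>y. proj_apply (formula_eval \<phi>) \<pi> y \<and> proj_apply (formula_eval \<psi>) \<pi> y)"
  by (simp add: proj_apply_def)

lemma proj_apply_Or:
  "proj_apply (formula_eval (Or \<phi> \<psi>)) \<pi> =
     (\<lambda>y. proj_apply (formula_eval \<phi>) \<pi> y \<or> proj_apply (formula_eval \<psi>) \<pi> y)"
  by (simp add: proj_apply_def)

text \<open>
  One step of the induction for both kinds of gates: \<open>D1\<close>, \<open>D2\<close> are the depths of the children and
  \<open>\<beta>1\<close>, \<open>\<beta>2\<close> their numbers of bottom gates.
\<close>

lemma bottom_gates_step:
  assumes h: "h = (\<lambda>y. f y \<and> g y) \<or> h = (\<lambda>y. f y \<or> g y)"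
    and f: "(\<exists>c. f = (\<lambda>_. c)) \<or> representable m f" and g: "(\<exists>c. g = (\<lambda>_. c)) \<or> representable m g"
    and f2: "2 \<le> formula_complexity m f \<Longrightarrow> 1 \<le> \<beta>1"
    and g2: "2 \<le> formula_complexity m g \<Longrightarrow> 1 \<le> \<beta>2"
    and fL: "formula_complexity m f \<le> 1 + D1 * \<beta>1"
    and gL: "formula_complexity m g \<le> 1 + D2 * \<beta>2"
    and \<beta>: "\<beta> = \<beta>1 + \<beta>2 + of_bool (distinct_literals m f g)"
  shows "((\<exists>c. h = (\<lambda>_. c)) \<or> representable m h) \<and>
         (2 \<le> formula_complexity m h \<longrightarrow> 1 \<le> \<beta>) \<and> formula_complexity m h \<le> 1 + Suc (max D1 D2) * \<beta>"
proof -
  define D where "D = max D1 D2"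
  have D: "D1 * x \<le> D * x" "D2 * x \<le> D * x" for x
    unfolding D_def by (intro mult_le_mono1; simp)+
  \<comment> \<open>If \<open>h\<close> collapses to a child or a constant, the three claims are
    inherited, since \<open>\<beta>\<close> is at least \<open>\<beta>1\<close> and
    \<open>\<beta>2\<close>.\<close>
  have const: ?thesis if "h = f \<or> h = g \<or> h = (\<lambda>_. True) \<or> h = (\<lambda>_. False)"
  proof -
    have "D1 * \<beta>1 \<le> Suc D * \<beta>" "D2 * \<beta>2 \<le> Suc D * \<beta>"
      unfolding D_def using \<beta> by (intro mult_le_mono; simp)+
    then have "formula_complexity m f \<le> 1 + Suc D * \<beta>" "formula_complexity m g \<le> 1 + Suc D * \<beta>"
      using fL gL by linarith+
    then show ?thesis
      using that f g f2 g2 \<beta> unfolding D_def[symmetric] by auto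
  qed
  show ?thesis
  proof (cases "(\<exists>c. f = (\<lambda>_. c)) \<or> (\<exists>c. g = (\<lambda>_. c))")
    case True
    then obtain c where "f = (\<lambda>_. c) \<or> g = (\<lambda>_. c)"
      by blast
    then have "h = f \<or> h = g \<or> h = (\<lambda>_. True) \<or> h = (\<lambda>_. False)"
      using h by (cases c) auto
    then show ?thesis
      by (rule const)
  next
    case False
    then have nc: "\<nexists>c. f = (\<lambda>_. c)" "\<nexists>c. g = (\<lambda>_. c)" and rep: "representable m f" "representable m g"
      using f g by auto
    obtain \<phi> \<psi> where \<phi>\<psi>: "formula_vars \<phi> \<subseteq> {..<m}" "formula_eval \<phi> = f"
      "formula_vars \<psi> \<subseteq> {..<m}" "formula_eval \<psi> = g"
      using rep unfolding representable_def by metis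
    have reph: "representable m h"
      using h
    proof
      assume "h = (\<lambda>y. f y \<and> g y)"
      then show ?thesis
        unfolding representable_def using \<phi>\<psi> by (intro exI[of _ "And \<phi> \<psi>"]) auto
    next
      assume "h = (\<lambda>y. f y \<or> g y)"
      then show ?thesis
        unfolding representable_def using \<phi>\<psi> by (intro exI[of _ "Or \<phi> \<psi>"]) auto
    qed
    have hL: "formula_complexity m h \<le> formula_complexity m f + formula_complexity m g"
      using h formula_complexity_conj_le[OF rep nc] formula_complexity_disj_le[OF rep nc] by auto
    show ?thesis
    proof (cases "2 \<le> formula_complexity m h")
      case True
      have "1 \<le> \<beta>"
      proof (cases "formula_complexity m f \<le> 1 \<and> formula_complexity m g \<le> 1")
        case True
        obtain b j where j: "j < m" "f = formula_eval (Lit b j)"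
          using complexity_le_1_imp_literal rep(1) nc(1) True by metis
        obtain c k where k: "k < m" "g = formula_eval (Lit c k)"
          using complexity_le_1_imp_literal rep(2) nc(2) True by metis
        \<comment> \<open>Over a single variable the gate would collapse to complexity at most
          1.\<close>
        have "j \<noteq> k"
        proof
          assume "j = k"
          then have "h = f \<or> h = (\<lambda>_. True) \<or> h = (\<lambda>_. False)"
            using h j(2) k(2) by (cases b; cases c) auto
          then show False
            using \<open>2 \<le> formula_complexity m h\<close> True by auto
        qed
        then show ?thesis
          using j k \<beta> unfolding distinct_literals_def by auto
      next
        case False
        then show ?thesis
          using f2 g2 \<beta> by auto
      qed
      \<comment> \<open>The two children give \<open>2 + D1 * \<beta>1 + D2 * \<beta>2\<close>, at
        most \<open>2 + D * \<beta>\<close>. As \<open>1 \<le> \<beta>\<close>, the surplus 1 is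
        absorbed by the additional level in \<open>Suc D * \<beta>\<close>.\<close>
      moreover have "D1 * \<beta>1 + D2 * \<beta>2 \<le> D * \<beta>"
        unfolding \<beta> distrib_left using D(1)[of \<beta>1] D(2)[of \<beta>2] by linarith
      ultimately show ?thesis
        using reph hL fL gL unfolding D_def[symmetric] mult_Suc by linarith
    next
      case False
      then show ?thesis
        using reph by simp
    qed
  qed
qed

text \<open>The three claims are proved together: complexity at least 2 supplies a bottom gate, and
  that gate pays for the second of the two additive units that arise when the children's bounds are
  added.\<close>

lemma formula_complexity_bottom_gates:
  assumes "\<pi> \<in> projections n m" "formula_vars \<phi> \<subseteq> {..<n}"
  shows "((\<exists>c. proj_apply (formula_eval \<phi>) \<pi> = (\<lambda>_. c)) \<or> representable m (proj_apply (formula_eval \<phi>) \<pi>)) \<and>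
    (2 \<le> formula_complexity m (proj_apply (formula_eval \<phi>) \<pi>) \<longrightarrow> 1 \<le> bottom_gates m \<phi> \<pi>) \<and>
    formula_complexity m (proj_apply (formula_eval \<phi>) \<pi>) \<le> 1 + formula_depth \<phi> * bottom_gates m \<phi> \<pi>"
  using assms(2)
proof (induction \<phi>)
  case (Lit b i)
  then have "\<pi> i \<in> proj_values m"
    using assms(1) by (auto simp: projections_def)
  then consider c where "\<pi> i = PConst c" | c j where "\<pi> i = PLit c j" "j < m"
    by (auto simp: proj_values_def)
  then show ?case
  proof cases
    case 1
    then have "proj_apply (formula_eval (Lit b i)) \<pi> = (\<lambda>_. c = b)"
      by (auto simp: proj_apply_def)
    then show ?thesis
      by (auto simp del: formula_eval.simps)
  next
    case 2
    \<comment> \<open>Composing the signs \<open>b\<close> and \<open>c\<close> gives a plain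
      variable exactly when they agree.\<close>
    then have "proj_apply (formula_eval (Lit b i)) \<pi> = formula_eval (Lit (c = b) j)"
      by (auto simp: proj_apply_def fun_eq_iff)
    moreover have "representable m (formula_eval (Lit (c = b) j))"
      unfolding representable_def using 2 by (intro exI[of _ "Lit (c = b) j"]) auto
    ultimately show ?thesis
      using formula_complexity_literal_le[OF \<open>j < m\<close>, of "c = b"] by (simp del: formula_eval.simps)
  qed
next
  case (And \<phi> \<psi>)
  then show ?case
    unfolding formula_depth.simps bottom_gates.simps
    by (intro bottom_gates_step[OF disjI1[OF proj_apply_And]]) auto
next
  case (Or \<phi> \<psi>)
  then show ?case
    unfolding formula_depth.simps bottom_gates.simps
    by (intro bottom_gates_step[OF disjI2[OF proj_apply_Or]]) auto
qed

text \<open>The additive 1 is too large to keep in the expectation. If the complexity is at least 2,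
  a bottom gate absorbs it, which raises the factor to \<open>Suc (formula_depth \<phi>)\<close>;
  otherwise the function is a constant or a literal.\<close>

lemma formula_complexity_le_literal_plus_bottom_gates:
  assumes \<pi>: "\<pi> \<in> projections n m" and vars: "formula_vars \<phi> \<subseteq> {..<n}"
  shows "formula_complexity m (proj_apply (formula_eval \<phi>) \<pi>)
       \<le> of_bool (\<exists>b. \<exists>j<m. proj_apply (formula_eval \<phi>) \<pi> = formula_eval (Lit b j))
         + Suc (formula_depth \<phi>) * bottom_gates m \<phi> \<pi>"
proof -
  let ?f = "proj_apply (formula_eval \<phi>) \<pi>"
  note * = formula_complexity_bottom_gates[OF assms]
  show ?thesis
  proof (cases "2 \<le> formula_complexity m ?f")
    case True
    then show ?thesis
      using * by simp
  next
    case False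
    show ?thesis
    proof (cases "\<exists>c. ?f = (\<lambda>_. c)")
      case True
      then show ?thesis
        by auto
    next
      case nc: False
      then obtain b j where "j < m" "?f = formula_eval (Lit b j)"
        using complexity_le_1_imp_literal[of m ?f] * False by (metis not_less_eq_eq numeral_2_eq_2 One_nat_def)
      then have "\<exists>b. \<exists>j<m. ?f = formula_eval (Lit b j)"
        by blast
      then show ?thesis
        using False by (simp del: formula_eval.simps)
    qed
  qed
qed

section \<open>Expectations\<close>

text \<open>Union bound over at most \<open>4 * m ^ 2\<close> choices of two signs and two
  variables. AM-GM replaces the geometric mean of the sizes by half their sum, so that the bounds
  can be added over all gates.\<close>

lemma prob_distinct_literals_le:
  assumes hid: "set_hiding n m Q p" and nonneg: "\<And>\<sigma>. 0 \<le> Q \<sigma>"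
    and vars: "formula_vars \<phi> \<subseteq> {..<n}" "formula_vars \<psi> \<subseteq> {..<n}"
  shows "measure_pmf.prob p {\<rho>. distinct_literals m (proj_apply (formula_eval \<phi>) \<rho>) (proj_apply (formula_eval \<psi>) \<rho>)}
       \<le> 2 * real m ^ 2 * (Q False * Q True) * (real (formula_size \<phi>) + real (formula_size \<psi>))"
proof -
  let ?I = "{(b, c, j, k). j < m \<and> k < m \<and> j \<noteq> k} :: (bool \<times> bool \<times> nat \<times> nat) set"
  let ?E = "\<lambda>(b, c, j, k). {\<rho>. proj_apply (formula_eval \<phi>) \<rho> = formula_eval (Lit b j) \<and>
                               proj_apply (formula_eval \<psi>) \<rho> = formula_eval (Lit c k)}"
  let ?s = "real (formula_size \<phi>)" and ?t = "real (formula_size \<psi>)"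
  have sub: "?I \<subseteq> UNIV \<times> UNIV \<times> {..<m} \<times> {..<m}"
    by auto
  then have fin: "finite ?I"
    by (rule finite_subset) simp
  have "card ?I \<le> card ((UNIV :: bool set) \<times> (UNIV :: bool set) \<times> {..<m} \<times> {..<m})"
    by (rule card_mono[OF _ sub]) simp
  then have "card ?I \<le> 4 * m ^ 2"
    by (simp add: power2_eq_square card_cartesian_product)
  then have "real (card ?I) \<le> real (4 * m ^ 2)"
    by (simp only: of_nat_le_iff)
  then have card: "real (card ?I) \<le> 4 * real m ^ 2"
    by simp
  have amgm: "sqrt (?s * ?t) \<le> (?s + ?t) / 2"
    by (rule arith_geo_mean_sqrt) auto
  have "{\<rho>. distinct_literals m (proj_apply (formula_eval \<phi>) \<rho>) (proj_apply (formula_eval \<psi>) \<rho>)}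
      = (\<Union>x\<in>?I. ?E x)"
    unfolding distinct_literals_def by (auto simp del: formula_eval.simps)
  then have "measure_pmf.prob p {\<rho>. distinct_literals m (proj_apply (formula_eval \<phi>) \<rho>) (proj_apply (formula_eval \<psi>) \<rho>)}
      = measure_pmf.prob p (\<Union>x\<in>?I. ?E x)"
    by simp
  also have "\<dots> \<le> (\<Sum>x\<in>?I. measure_pmf.prob p (?E x))"
    by (rule measure_pmf.finite_measure_subadditive_finite[OF fin]) auto
  also have "\<dots> \<le> real (card ?I) * (Q False * Q True * sqrt (?s * ?t))"
  proof (rule sum_bounded_above)
    fix x assume "x \<in> ?I"
    then obtain b c j k where x: "x = (b, c, j, k)" and jk: "j < m" "k < m" "j \<noteq> k"
      by blast
    show "measure_pmf.prob p (?E x) \<le> Q False * Q True * sqrt (?s * ?t)"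
      unfolding x prod.case by (rule prob_two_literals_le[OF hid nonneg jk vars])
  qed
  also have "\<dots> \<le> (4 * real m ^ 2) * (Q False * Q True * ((?s + ?t) / 2))"
    using card amgm nonneg by (intro mult_mono) auto
  finally show ?thesis
    by (simp add: algebra_simps)
qed

text \<open>Each gate costs at most \<open>K\<close> times the number of leaves below it, and a leaf
  has at most depth many gates above it; hence depth times size. The step adds the cost of the top
  gate as one more level.\<close>

lemma expectation_bottom_gates_step:
  assumes fin: "finite (set_pmf p)"
    and \<phi>: "measure_pmf.expectation p (\<lambda>\<pi>. real (bottom_gates m \<phi> \<pi>)) \<le> K * (real d1 * real s1)"
    and \<psi>: "measure_pmf.expectation p (\<lambda>\<pi>. real (bottom_gates m \<psi> \<pi>)) \<le> K * (real d2 * real s2)"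
    and E: "measure_pmf.prob p {\<pi>. E \<pi>} \<le> K * (real s1 + real s2)" and K: "0 \<le> K"
  shows "measure_pmf.expectation p (\<lambda>\<pi>. real (bottom_gates m \<phi> \<pi> + bottom_gates m \<psi> \<pi> + of_bool (E \<pi>)))
       \<le> K * (real (Suc (max d1 d2)) * real (s1 + s2))"
proof -
  have int: "integrable (measure_pmf p) f" for f :: "_ \<Rightarrow> real"
    by (rule integrable_measure_pmf_finite[OF fin])
  have "measure_pmf.expectation p (\<lambda>\<pi>. real (of_bool (E \<pi>))) = measure_pmf.expectation p (indicator {\<pi>. E \<pi>})"
    by (rule Bochner_Integration.integral_cong) (auto simp: indicator_def)
  also have "\<dots> = measure_pmf.prob p {\<pi>. E \<pi>}"
    by simp
  finally have "measure_pmf.expectation p (\<lambda>\<pi>. real (bottom_gates m \<phi> \<pi> + bottom_gates m \<psi> \<pi> + of_bool (E \<pi>)))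
      = measure_pmf.expectation p (\<lambda>\<pi>. real (bottom_gates m \<phi> \<pi>)) +
        measure_pmf.expectation p (\<lambda>\<pi>. real (bottom_gates m \<psi> \<pi>)) + measure_pmf.prob p {\<pi>. E \<pi>}"
    by (simp only: of_nat_add Bochner_Integration.integral_add int)
  also have "\<dots> \<le> K * (real d1 * real s1) + K * (real d2 * real s2) + K * (real s1 + real s2)"
    using \<phi> \<psi> E by linarith
  also have "\<dots> \<le> K * (real (max d1 d2) * real s1) + K * (real (max d1 d2) * real s2) + K * (real s1 + real s2)"
    using K by (intro add_mono mult_left_mono mult_right_mono) auto
  also have "\<dots> = K * (real (Suc (max d1 d2)) * real (s1 + s2))"
    by (simp add: algebra_simps del: of_nat_max)
  finally show ?thesis .
qed

lemma expectation_bottom_gates_le: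
  assumes fin: "finite (set_pmf p)" and hid: "set_hiding n m Q p" and nonneg: "\<And>\<sigma>. 0 \<le> Q \<sigma>"
    and "formula_vars \<phi> \<subseteq> {..<n}"
  shows "measure_pmf.expectation p (\<lambda>\<pi>. real (bottom_gates m \<phi> \<pi>))
       \<le> 2 * real m ^ 2 * (Q False * Q True) * (real (formula_depth \<phi>) * real (formula_size \<phi>))"
  using assms(4)
proof (induction \<phi>)
  case (Lit b i)
  then show ?case by simp
next
  case (And \<phi> \<psi>)
  then show ?case
    unfolding bottom_gates.simps formula_depth.simps formula_size.simps
    by (intro expectation_bottom_gates_step[OF fin] prob_distinct_literals_le[OF hid nonneg])
       (use nonneg in auto)
next
  case (Or \<phi> \<psi>)
  then show ?case
    unfolding bottom_gates.simps formula_depth.simps formula_size.simps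
    by (intro expectation_bottom_gates_step[OF fin] prob_distinct_literals_le[OF hid nonneg])
       (use nonneg in auto)
qed

lemma prob_some_literal_le:
  assumes hid: "set_hiding n m Q p" and nonneg: "\<And>\<sigma>. 0 \<le> Q \<sigma>"
    and vars: "formula_vars \<phi> \<subseteq> {..<n}"
  shows "measure_pmf.prob p {\<rho>. \<exists>b. \<exists>j<m. proj_apply (formula_eval \<phi>) \<rho> = formula_eval (Lit b j)}
       \<le> 2 * real m * (sqrt (Q False * Q True) * sqrt (formula_size \<phi>))"
proof -
  let ?I = "(UNIV :: bool set) \<times> {..<m}"
  let ?E = "\<lambda>(b, j). {\<rho>. proj_apply (formula_eval \<phi>) \<rho> = formula_eval (Lit b j)}"
  have "{\<rho>. \<exists>b. \<exists>j<m. proj_apply (formula_eval \<phi>) \<rho> = formula_eval (Lit b j)} = (\<Union>x\<in>?I. ?E x)"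
    by (auto simp del: formula_eval.simps)
  then have "measure_pmf.prob p {\<rho>. \<exists>b. \<exists>j<m. proj_apply (formula_eval \<phi>) \<rho> = formula_eval (Lit b j)}
      = measure_pmf.prob p (\<Union>x\<in>?I. ?E x)"
    by simp
  also have "\<dots> \<le> (\<Sum>x\<in>?I. measure_pmf.prob p (?E x))"
    by (rule measure_pmf.finite_measure_subadditive_finite) auto
  also have "\<dots> \<le> real (card ?I) * (sqrt (Q False * Q True) * sqrt (formula_size \<phi>))"
  proof (rule sum_bounded_above)
    fix x assume "x \<in> ?I"
    then obtain b j where x: "x = (b, j)" and j: "j < m"
      by blast
    show "measure_pmf.prob p (?E x) \<le> sqrt (Q False * Q True) * sqrt (formula_size \<phi>)"
      unfolding x prod.case by (rule prob_literal_le[OF hid nonneg j vars])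
  qed
  finally show ?thesis
    by (simp add: card_cartesian_product)
qed

lemma expectation_formula_complexity_le:
  assumes rp: "random_projection n m p" and hid: "hiding n m q p"
    and vars: "formula_vars \<phi> \<subseteq> {..<n}" and m: "0 < m"
  shows "0 \<le> q" and "measure_pmf.expectation p (\<lambda>\<pi>. real (formula_complexity m (proj_apply (formula_eval \<phi>) \<pi>)))
    \<le> 2 * real m * (q * sqrt (formula_size \<phi>)) +
      real (Suc (formula_depth \<phi>)) * (2 * real m ^ 2 * q\<^sup>2 * (real (formula_depth \<phi>) * real (formula_size \<phi>)))"
proof -
  obtain q0 q1 where h2: "hiding2 n m q0 q1 p" and q: "q = sqrt (q0 * q1)"
    using hid unfolding hiding_def by blast
  define Q where "Q = (\<lambda>\<sigma>. if \<sigma> then q1 else q0)"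
  have sh: "set_hiding n m Q p"
    unfolding Q_def using hiding2_imp_set_hiding[OF rp h2] .
  \<comment> \<open>A formula has at least one leaf, so \<open>0 < n\<close>, and the parameters are
    nonnegative.\<close>
  have "formula_vars \<phi> \<noteq> {}"
    by (induction \<phi>) auto
  then have "0 < n"
    using vars by auto
  then have nonneg: "0 \<le> Q \<sigma>" for \<sigma>
    using set_hiding_nonneg[OF sh] m by blast
  \<comment> \<open>\<open>sqrt\<close> of a negative real is negative, so this sign is needed both
    for \<open>0 \<le> q\<close> and for \<open>q\<^sup>2 = q0 * q1\<close>.\<close>
  then have "0 \<le> q0 * q1"
    using nonneg[of False] nonneg[of True] by (simp add: Q_def)
  then show q_nonneg: "0 \<le> q"
    unfolding q by simp
  have Q: "Q False * Q True = q\<^sup>2"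
    using \<open>0 \<le> q0 * q1\<close> by (simp add: Q_def q)
  have fin: "finite (set_pmf p)"
    using rp by (rule finite_set_pmf_random_projection)
  have int: "integrable (measure_pmf p) f" for f :: "_ \<Rightarrow> real"
    by (rule integrable_measure_pmf_finite[OF fin])
  let ?S = "{\<rho>. \<exists>b. \<exists>j<m. proj_apply (formula_eval \<phi>) \<rho> = formula_eval (Lit b j)}"
  let ?D = "real (Suc (formula_depth \<phi>))"
  have "measure_pmf.expectation p (\<lambda>\<pi>. real (formula_complexity m (proj_apply (formula_eval \<phi>) \<pi>)))
      \<le> measure_pmf.expectation p (\<lambda>\<pi>. indicator ?S \<pi> + ?D * real (bottom_gates m \<phi> \<pi>))"
  \<comment> \<open>The pointwise bound holds for projections only, hence the comparison on the
    support.\<close>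
  proof (rule integral_mono_AE[OF int int], unfold AE_measure_pmf_iff, rule ballI)
    fix \<pi> assume "\<pi> \<in> set_pmf p"
    then have "\<pi> \<in> projections n m"
      using rp by (auto simp: random_projection_def)
    then have "real (formula_complexity m (proj_apply (formula_eval \<phi>) \<pi>))
        \<le> real (of_bool (\<exists>b. \<exists>j<m. proj_apply (formula_eval \<phi>) \<pi> = formula_eval (Lit b j))
          + Suc (formula_depth \<phi>) * bottom_gates m \<phi> \<pi>)"
      unfolding of_nat_le_iff by (rule formula_complexity_le_literal_plus_bottom_gates[OF _ vars])
    then show "real (formula_complexity m (proj_apply (formula_eval \<phi>) \<pi>))
        \<le> indicator ?S \<pi> + ?D * real (bottom_gates m \<phi> \<pi>)"
      by (simp only: of_nat_add of_nat_mult of_nat_of_bool indicator_def mem_Collect_eq)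
  qed
  also have "\<dots> = measure_pmf.prob p ?S + ?D * measure_pmf.expectation p (\<lambda>\<pi>. real (bottom_gates m \<phi> \<pi>))"
    by (subst Bochner_Integration.integral_add[OF int int]) simp
  also have "\<dots> \<le> 2 * real m * (q * sqrt (formula_size \<phi>)) +
      ?D * (2 * real m ^ 2 * q\<^sup>2 * (real (formula_depth \<phi>) * real (formula_size \<phi>)))"
    using q_nonneg prob_some_literal_le[OF sh nonneg vars] expectation_bottom_gates_le[OF fin sh nonneg vars]
    unfolding Q by (intro add_mono mult_left_mono) simp_all
  finally show "measure_pmf.expectation p (\<lambda>\<pi>. real (formula_complexity m (proj_apply (formula_eval \<phi>) \<pi>)))
    \<le> 2 * real m * (q * sqrt (formula_size \<phi>)) +
      ?D * (2 * real m ^ 2 * q\<^sup>2 * (real (formula_depth \<phi>) * real (formula_size \<phi>)))" .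
qed

text \<open>For \<open>m = 0\<close> hiding is vacuous and leaves the sign of \<open>q\<close> open.
  Here every \<open>x_i\<close> becomes a constant, and so does the restricted function.\<close>

lemma expectation_formula_complexity_no_variables:
  assumes "random_projection n 0 p" "formula_vars \<phi> \<subseteq> {..<n}"
  shows "measure_pmf.expectation p (\<lambda>\<pi>. real (formula_complexity 0 (proj_apply (formula_eval \<phi>) \<pi>))) = 0"
proof (rule integral_eq_zero_AE, unfold AE_measure_pmf_iff, rule ballI)
  fix \<pi> assume "\<pi> \<in> set_pmf p"
  then have \<pi>: "\<pi> i \<in> range PConst" if "i < n" for i
    using assms(1) that by (auto simp: random_projection_def projections_def proj_values_def)
  have "proj_apply (formula_eval \<phi>) \<pi> y = proj_apply (formula_eval \<phi>) \<pi> (\<lambda>_. False)" for y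
    unfolding proj_apply_def
    by (rule formula_eval_cong) (use \<pi> assms(2) in fastforce)
  then show "real (formula_complexity 0 (proj_apply (formula_eval \<phi>) \<pi>)) = 0"
    by (auto simp: formula_complexity_def)
qed

theorem theorem4p5:
  shows "\<exists>C::real. C > 0 \<and>
    (\<forall>(n::nat) (m::nat) (s::nat) (d::nat) (q::real) (\<phi>::formula) (p::(nat \<Rightarrow> proj_value) pmf).
       formula_vars \<phi> \<subseteq> {..<n} \<longrightarrow> formula_size \<phi> = s \<longrightarrow> formula_depth \<phi> = d \<longrightarrow>
       random_projection n m p \<longrightarrow> hiding n m q p \<longrightarrow>
       measure_pmf.expectation p (\<lambda>\<pi>. real (formula_complexity m (proj_apply (formula_eval \<phi>) \<pi>)))
         \<le> C * (real m ^ 4 * q\<^sup>2 * real d ^ 2 * real s + real m ^ 2 * q * sqrt (real s)))"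
proof (intro exI[of _ 4] conjI allI impI)
  fix n m s d q \<phi> and p :: "(nat \<Rightarrow> proj_value) pmf"
  assume vars: "formula_vars \<phi> \<subseteq> {..<n}" and s: "formula_size \<phi> = s" and d: "formula_depth \<phi> = d"
    and rp: "random_projection n m p" and hid: "hiding n m q p"
  let ?E = "measure_pmf.expectation p (\<lambda>\<pi>. real (formula_complexity m (proj_apply (formula_eval \<phi>) \<pi>)))"
  show "?E \<le> 4 * (real m ^ 4 * q\<^sup>2 * real d ^ 2 * real s + real m ^ 2 * q * sqrt (real s))"
  proof (cases "m = 0")
    case True
    then show ?thesis
      using expectation_formula_complexity_no_variables[of n p \<phi>] rp vars by simp
  next
    case False
    then have m: "0 < m" by simp
    note bound = expectation_formula_complexity_le[OF rp hid vars m, unfolded s d]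
    \<comment> \<open>The bound obtained has \<open>m\<close> and \<open>m ^ 2\<close> where the
      claim has \<open>m ^ 2\<close> and \<open>m ^ 4\<close>.\<close>
    have "m ^ 1 \<le> m ^ 2" "m ^ 2 \<le> m ^ 4"
      using m by (intro power_increasing; simp)+
    then have m2: "real m \<le> real m ^ 2" and m4: "real m ^ 2 \<le> real m ^ 4"
      by (metis of_nat_le_iff of_nat_power power_one_right)+
    have "2 * real m * (q * sqrt s) \<le> 4 * real m ^ 2 * (q * sqrt s)"
      using m2 bound(1) by (intro mult_right_mono) (linarith, simp)
    moreover have "real (Suc d) * (2 * real m ^ 2 * q\<^sup>2 * (real d * real s))
        \<le> 4 * real m ^ 4 * q\<^sup>2 * real d ^ 2 * real s"
    proof -
      \<comment> \<open>For \<open>d = 0\<close> both sides vanish, thanks to the factor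
        \<open>d\<close> from counting bottom gates; otherwise \<open>d + 1 \<le> 2 * d\<close>.
        With the 2 from the union bound this gives the constant 4.\<close>
      have "Suc d * d \<le> 2 * d ^ 2"
        by (cases d) (auto simp: power2_eq_square)
      then have "real (Suc d * d) \<le> real (2 * d ^ 2)"
        by (simp only: of_nat_le_iff)
      then have "real (Suc d) * real d \<le> 2 * real d ^ 2"
        by (simp add: algebra_simps)
      then have "(real (Suc d) * real d) * (real m ^ 2 * (2 * q\<^sup>2 * real s))
          \<le> (2 * real d ^ 2) * (real m ^ 4 * (2 * q\<^sup>2 * real s))"
        by (rule mult_mono[OF _ mult_right_mono[OF m4]]) auto
      then show ?thesis
        by (simp add: algebra_simps)
    qed
    ultimately show ?thesis
      using bound(2) by (simp add: algebra_simps)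
  qed
qed simp

end
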